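(* Let $k$ be a field with algebraic closure $\overline{k}$. Let $f(x)=a_nx^n+\ldots+a_0\in k[x]$ with $a_n,a_0\neq 0$. Let $r_1,\ldots,r_s\in\overline{k}$ be the distinct roots of $f$, with multiplicities $m_1,\ldots,m_s$. Then $\operatorname{tol}(f)=\operatorname{tol}(f^* )$ if and only if $$\prod_{1\leq i<j\leq s}(r_ir_j)^{2m_im_j}=\left(\frac{a_0}{a_n}\right)^{2n-2}.$$
   Context: For a polynomial $f=a_nx^n+\ldots+a_0\in k[x]$ with $a_n\neq 0$ and factorization $f=a_n\prod_{i=1}^s(x-r_i)^{m_i}$ over $\overline{k}$, where $r_1,\ldots,r_s$ are distinct and $m_i\geq 1$, the tolerant of $f$ is $\operatorname{tol}(f):=a_n^{2n-2}\prod_{1\leq i<j\leq s}(r_i-r_j)^{2m_im_j}$. If $f(0)\neq 0$, the reciprocal of $f$ is $f^*(x)=x^{\deg(f)}\cdot f(\tfrac{1}{x})$. *)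

theory Defs
  imports "HOL-Algebra.Algebraic_Closure_Type"
begin

text \<open>
  HOL-Algebra also has constants called \<open>order\<close>, \<open>degree\<close> and \<open>monom\<close>; the type-class
  ones are meant throughout, hence the qualified names.
\<close>

abbreviation over_closure :: "'a::field poly \<Rightarrow> 'a alg_closure poly" where
  "over_closure f \<equiv> map_poly to_ac f"

definition distinct_roots :: "'a::field poly \<Rightarrow> 'a alg_closure set" where
  "distinct_roots f = {x. poly (over_closure f) x = 0}"

definition root_mult :: "'a::field poly \<Rightarrow> 'a alg_closure \<Rightarrow> nat" where
  "root_mult f x = Polynomial.order x (over_closure f)"

definition index_pairs :: "nat \<Rightarrow> (nat \<times> nat) set" where
  "index_pairs s = {(i, j). 1 \<le> i \<and> i < j \<and> j \<le> s}"

text \<open>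
  The enumeration of the roots is an arbitrary one; it exists for \<open>f \<noteq> 0\<close> by \<open>finite_distinct_roots\<close>
  below, and \<open>tol_eq\<close> shows that the choice is immaterial. The exponent of the leading coefficient is an integer, since \<open>2 n - 2\<close> is negative
  for a constant \<open>f\<close>. The value is taken in the algebraic closure.
\<close>

definition tol :: "'a::field poly \<Rightarrow> 'a alg_closure" where
  "tol f = (let s = card (distinct_roots f);
                r = (SOME r. bij_betw r {1..s} (distinct_roots f))
            in to_ac (lead_coeff f) powi (2 * int (Polynomial.degree f) - 2) *
               (\<Prod>(i, j)\<in>index_pairs s. (r i - r j) ^ (2 * root_mult f (r i) * root_mult f (r j))))"

text \<open>
  For \<open>f\<close> with nonzero constant term, the reciprocal of \<open>f\<close> is the library's \<open>reflect_poly f\<close>,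
  cf. \<open>poly_reflect_poly_nz\<close>.
\<close>

abbreviation reciprocal :: "'a::field poly \<Rightarrow> 'a poly" where
  "reciprocal f \<equiv> reflect_poly f"

lemma finite_distinct_roots:
  assumes "f \<noteq> 0"
  shows "finite (distinct_roots f)"
proof -
  have "over_closure f \<noteq> 0"
    using assms by (simp add: map_poly_eq_0_iff)
  then show ?thesis
    unfolding distinct_roots_def by (rule poly_roots_finite)
qed

lemma prod_index_pairs:
  fixes h :: "'b \<Rightarrow> 'b \<Rightarrow> 'c::comm_monoid_mult"
  assumes bij: "bij_betw r {1..s} R" and sym: "\<And>x y. h x y = h y x"
  shows "(\<Prod>(i, j)\<in>index_pairs s. h (r i) (r j)) =
         (\<Prod>e | e \<subseteq> R \<and> card e = 2. THE v. \<exists>x y. e = {x, y} \<and> v = h x y)"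
proof (rule prod.reindex_bij_witness_not_neutral
    [where S' = "{}" and T' = "{}" and j = "\<lambda>(i, j). {r i, r j}"
       and i = "\<lambda>e. (Min (r -` e \<inter> {1..s}), Max (r -` e \<inter> {1..s}))"])
  have inj: "inj_on r {1..s}" and im: "r ` {1..s} = R"
    using bij by (auto simp: bij_betw_def)
  have vim: "r -` {r i, r j} \<inter> {1..s} = {i, j}" if "(i, j) \<in> index_pairs s" for i j
    using that inj by (auto simp: index_pairs_def dest: inj_onD)
  have pairs: "\<exists>i j. (i, j) \<in> index_pairs s \<and> e = {r i, r j}" if e: "e \<subseteq> R" "card e = 2" for e
  proof -
    obtain x y where xy: "e = {x, y}" "x \<noteq> y"
      using e(2) by (auto simp: card_2_iff)
    then obtain i j where ij: "i \<in> {1..s}" "j \<in> {1..s}" "x = r i" "y = r j"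
      using e(1) im by blast
    with xy have "i < j \<or> j < i" by (metis linorder_neqE_nat)
    then show ?thesis
    proof
      assume "i < j"
      with ij xy show ?thesis by (intro exI[of _ i] exI[of _ j]) (auto simp: index_pairs_def)
    next
      assume "j < i"
      with ij xy show ?thesis by (intro exI[of _ j] exI[of _ i]) (auto simp: index_pairs_def)
    qed
  qed
  show "finite {}" "finite {}" by simp_all
  show "(\<lambda>e. (Min (r -` e \<inter> {1..s}), Max (r -` e \<inter> {1..s}))) ((\<lambda>(i, j). {r i, r j}) p) = p"
    if "p \<in> index_pairs s - {}" for p
  proof (cases p)
    case (Pair i j)
    with that vim[of i j] show ?thesis
      by (auto simp: index_pairs_def min_def max_def)
  qed
  show "(\<lambda>(i, j). {r i, r j}) p \<in> {e. e \<subseteq> R \<and> card e = 2} - {}"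
    if "p \<in> index_pairs s - {}" for p
  proof (cases p)
    case (Pair i j)
    with that have "i \<in> {1..s}" "j \<in> {1..s}" "i \<noteq> j"
      by (auto simp: index_pairs_def)
    moreover from this have "r i \<noteq> r j"
      by (simp only: inj_on_eq_iff[OF inj] not_False_eq_True)
    ultimately have "{r i, r j} \<subseteq> R" "card {r i, r j} = 2"
      using im by (blast, simp)
    then show ?thesis
      unfolding Pair by simp
  qed
  show "(\<lambda>(i, j). {r i, r j}) ((\<lambda>e. (Min (r -` e \<inter> {1..s}), Max (r -` e \<inter> {1..s}))) e) = e"
    "(\<lambda>e. (Min (r -` e \<inter> {1..s}), Max (r -` e \<inter> {1..s}))) e \<in> index_pairs s - {}"
    if e_in: "e \<in> {e. e \<subseteq> R \<and> card e = 2} - {}" for e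
  proof -
    obtain i j where ij: "(i, j) \<in> index_pairs s" "e = {r i, r j}"
      using pairs[of e] e_in by blast
    have "Min {i, j} = i" "Max {i, j} = j"
      using ij(1) by (auto simp: index_pairs_def)
    then have e: "(Min (r -` e \<inter> {1..s}), Max (r -` e \<inter> {1..s})) = (i, j)"
      by (simp only: ij(2) vim[OF ij(1)])
    show "(\<lambda>(i, j). {r i, r j}) ((\<lambda>e. (Min (r -` e \<inter> {1..s}), Max (r -` e \<inter> {1..s}))) e) = e"
      unfolding e by (simp only: ij(2) prod.case)
    show "(\<lambda>e. (Min (r -` e \<inter> {1..s}), Max (r -` e \<inter> {1..s}))) e \<in> index_pairs s - {}"
      unfolding e using ij(1) by blast
  qed
  show "(THE v. \<exists>x y. (\<lambda>(i, j). {r i, r j}) p = {x, y} \<and> v = h x y) =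
        (case p of (i, j) \<Rightarrow> h (r i) (r j))"
    if "p \<in> index_pairs s" for p
  proof (cases p)
    case (Pair i j)
    have "(THE v. \<exists>x y. {r i, r j} = {x, y} \<and> v = h x y) = h (r i) (r j)"
    proof (rule the_equality)
      show "\<exists>x y. {r i, r j} = {x, y} \<and> h (r i) (r j) = h x y"
        by blast
      fix v assume "\<exists>x y. {r i, r j} = {x, y} \<and> v = h x y"
      then obtain x y where "{r i, r j} = {x, y}" "v = h x y"
        by blast
      then show "v = h (r i) (r j)"
        using sym[of "r i" "r j"] by (auto simp only: doubleton_eq_iff)
    qed
    then show ?thesis
      unfolding Pair by (simp only: prod.case)
  qed
qed simp_all

lemma tol_eq:
  fixes f :: "'a::field poly"
  assumes enum: "bij_betw r {1..s} (distinct_roots f)"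
  shows "tol f = to_ac (lead_coeff f) powi (2 * int (Polynomial.degree f) - 2) *
           (\<Prod>(i, j)\<in>index_pairs s. (r i - r j) ^ (2 * root_mult f (r i) * root_mult f (r j)))"
proof -
  define h where "h x y = (x - y) ^ (2 * root_mult f x * root_mult f y)" for x y
  have sym: "h x y = h y x" for x y
  proof -
    have "h x y = ((x - y)\<^sup>2) ^ (root_mult f x * root_mult f y)"
      unfolding h_def mult.assoc by (rule power_mult)
    also have "\<dots> = ((y - x)\<^sup>2) ^ (root_mult f y * root_mult f x)"
      by (rule arg_cong2[where f = power, OF power2_commute mult.commute])
    also have "\<dots> = h y x"
      unfolding h_def mult.assoc by (rule power_mult[symmetric])
    finally show ?thesis .
  qed
  have s: "card (distinct_roots f) = s"
    using bij_betw_same_card[OF enum] by simp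
  define r' where "r' = (SOME r. bij_betw r {1..s} (distinct_roots f))"
  have "bij_betw r' {1..s} (distinct_roots f)"
    unfolding r'_def using enum
    by (rule someI[where P = "\<lambda>r. bij_betw r {1..s} (distinct_roots f)"])
  then have "(\<Prod>(i, j)\<in>index_pairs s. h (r' i) (r' j)) = (\<Prod>(i, j)\<in>index_pairs s. h (r i) (r j))"
    by (rule trans[OF prod_index_pairs[where h = h, OF _ sym]
                      prod_index_pairs[where h = h, OF enum sym, symmetric]])
  then show ?thesis
    by (simp only: tol_def Let_def s r'_def[symmetric] h_def)
qed

end

theory Submission
  imports Defs
begin

text \<open>
  The roots of the reciprocal \<open>f\<^sup>*\<close> are the inverses of the roots of \<open>f\<close>, with the same
  multiplicities (\<open>distinct_roots_reciprocal\<close>, \<open>root_mult_reciprocal\<close>), and its leading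
  coefficient is \<open>a\<^sub>0\<close>. Since
  \<open>1/r\<^sub>i - 1/r\<^sub>j = (r\<^sub>j - r\<^sub>i) / (r\<^sub>i r\<^sub>j)\<close> and all exponents \<open>2 m\<^sub>i m\<^sub>j\<close> are even, the tolerant of
  \<open>f\<^sup>*\<close> is \<open>a\<^sub>0\<^bsup>2n-2\<^esup> D / P\<close>, where \<open>D\<close> is the product of the root differences occurring in
  \<open>tol f = a\<^sub>n\<^bsup>2n-2\<^esup> D\<close> and \<open>P\<close> is the product of the \<open>(r\<^sub>i r\<^sub>j)\<^bsup>2 m\<^sub>i m\<^sub>j\<^esup>\<close>. The roots being distinct and
  nonzero, \<open>D\<close> and \<open>P\<close> do not vanish, so that cancelling \<open>D\<close> turns the equality of the two
  tolerants into \<open>P = (a\<^sub>0 / a\<^sub>n)\<^bsup>2n-2\<^esup>\<close>.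
\<close>

lemma over_closure_reciprocal: "over_closure (reciprocal f) = reflect_poly (over_closure f)"
  by (rule poly_eqI) (simp add: coeff_map_poly coeff_reflect_poly degree_map_poly)

text \<open>
  Reflection is multiplicative and takes \<open>X - x\<close> to \<open>1 - x X\<close>, whose only root is \<open>1/x\<close>, a simple
  one. Splitting off the full power of \<open>X - x\<close> leaves a cofactor \<open>q\<close> with \<open>q(x) \<noteq> 0\<close>, and its
  reflection does not vanish at \<open>1/x\<close>.
\<close>

lemma order_reflect_poly:
  fixes p :: "'b::field poly"
  assumes "p \<noteq> 0" and "x \<noteq> 0"
  shows "Polynomial.order (inverse x) (reflect_poly p) = Polynomial.order x p"
proof -
  define k where "k = Polynomial.order x p"
  obtain q where p: "p = [:-x, 1:] ^ k * q" and q: "\<not> [:-x, 1:] dvd q"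
    using order_decomp[OF assms(1), of x] unfolding k_def by blast
  have linear: "reflect_poly [:-x, 1:] = smult (-x) [:-inverse x, 1:]"
    using assms(2) by (simp add: reflect_poly_pCons)
  have "poly (reflect_poly q) (inverse x) \<noteq> 0"
    using assms(2) q by (simp add: poly_reflect_poly_nz poly_eq_0_iff_dvd)
  then have cofactor: "Polynomial.order (inverse x) (reflect_poly q) = 0"
    by (rule order_0I)
  have "reflect_poly p = smult ((-x) ^ k) ([:-inverse x, 1:] ^ k * reflect_poly q)"
    unfolding p by (simp only: reflect_poly_mult reflect_poly_power linear smult_power mult_smult_left)
  moreover have "[:-inverse x, 1:] ^ k * reflect_poly q \<noteq> 0"
    using q by auto
  ultimately show ?thesis
    using assms(2) cofactor
    by (simp add: order_smult order_mult order_power_n_n k_def)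
qed

lemma root_mult_reciprocal:
  assumes "f \<noteq> 0" and "x \<noteq> 0"
  shows "root_mult (reciprocal f) (inverse x) = root_mult f x"
  using assms by (simp add: root_mult_def over_closure_reciprocal order_reflect_poly map_poly_eq_0_iff)

lemma zero_notin_distinct_roots:
  assumes "Polynomial.coeff f 0 \<noteq> 0"
  shows "0 \<notin> distinct_roots f"
  using assms by (simp add: distinct_roots_def poly_0_coeff_0 coeff_map_poly)

lemma distinct_roots_reciprocal:
  assumes "Polynomial.coeff f 0 \<noteq> 0"
  shows "distinct_roots (reciprocal f) = inverse ` distinct_roots f"
proof -
  have nonzero: "x \<noteq> 0" if "x \<in> distinct_roots (reciprocal f)" for x
  proof -
    have "f \<noteq> 0"
      using assms by auto
    then show ?thesis
      using that zero_notin_distinct_roots[of "reciprocal f"] by auto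
  qed
  have root_iff: "x \<in> distinct_roots (reciprocal f) \<longleftrightarrow> inverse x \<in> distinct_roots f"
    if "x \<noteq> 0" for x
    using that by (simp add: distinct_roots_def over_closure_reciprocal poly_reflect_poly_nz)
  show ?thesis
  proof (intro Set.set_eqI iffI)
    fix x assume x: "x \<in> distinct_roots (reciprocal f)"
    then show "x \<in> inverse ` distinct_roots f"
      using root_iff[OF nonzero[OF x]] by (intro image_eqI[of _ _ "inverse x"]) auto
  next
    fix x assume "x \<in> inverse ` distinct_roots f"
    then obtain y where y: "x = inverse y" "y \<in> distinct_roots f"
      by blast
    moreover have "y \<noteq> 0"
      using y zero_notin_distinct_roots[OF assms] by auto
    ultimately show "x \<in> distinct_roots (reciprocal f)"
      using root_iff[of x] by simp
  qed
qed

lemma finite_index_pairs: "finite (index_pairs s)"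
  by (rule finite_subset[of _ "{1..s} \<times> {1..s}"]) (auto simp: index_pairs_def)

text \<open>
  The sign of \<open>y - x\<close> in \<open>1/x - 1/y = (y - x) / (x y)\<close> is absorbed by the even exponent.
\<close>

lemma inverse_diff_even_power:
  fixes x y :: "'b::field"
  assumes "x \<noteq> 0" and "y \<noteq> 0"
  shows "(inverse x - inverse y) ^ (2 * k) = (x - y) ^ (2 * k) / (x * y) ^ (2 * k)"
proof -
  have "inverse x - inverse y = (y - x) / (x * y)"
    using assms by (simp add: field_simps)
  then have "(inverse x - inverse y) ^ (2 * k) = (y - x) ^ (2 * k) / (x * y) ^ (2 * k)"
    by (simp add: power_divide)
  also have "(y - x) ^ (2 * k) = (x - y) ^ (2 * k)"
    by (simp only: power_mult power2_commute[of y x])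
  finally show ?thesis .
qed

theorem proposition2p14:
  fixes f :: "'a::field poly" and a :: "nat \<Rightarrow> 'a" and n s :: nat
    and r :: "nat \<Rightarrow> 'a alg_closure" and m :: "nat \<Rightarrow> nat"
  assumes "f = (\<Sum>i\<le>n. Polynomial.monom (a i) i)"
    and "a n \<noteq> 0" and "a 0 \<noteq> 0"
    and "bij_betw r {1..s} (distinct_roots f)"
    and "\<And>i. i \<in> {1..s} \<Longrightarrow> m i = root_mult f (r i)"
  shows "tol f = tol (reciprocal f) \<longleftrightarrow>
    (\<Prod>(i, j)\<in>index_pairs s. (r i * r j) ^ (2 * m i * m j)) =
      to_ac (a 0 / a n) powi (2 * int n - 2)"
proof -
  have coeff: "Polynomial.coeff f i = (if i \<le> n then a i else 0)" for i
    by (simp add: assms(1) coeff_sum)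
  have deg: "Polynomial.degree f = n"
    using assms(2) by (intro antisym degree_le le_degree) (simp_all add: coeff)
  have c0: "Polynomial.coeff f 0 \<noteq> 0"
    using assms(3) by (simp add: coeff)
  then have f0: "f \<noteq> 0"
    by auto
  have root: "r i \<in> distinct_roots f" if "i \<in> {1..s}" for i
    using that bij_betwE[OF assms(4)] by blast
  have r0: "r i \<noteq> 0" if "i \<in> {1..s}" for i
    using root[OF that] zero_notin_distinct_roots[OF c0] by auto
  have pairD: "i \<in> {1..s}" "j \<in> {1..s}" "i \<noteq> j" if "(i, j) \<in> index_pairs s" for i j
    using that by (auto simp: index_pairs_def)
  have "bij_betw inverse (distinct_roots f) (distinct_roots (reciprocal f))"
    by (simp add: bij_betw_def distinct_roots_reciprocal[OF c0] inj_on_def)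
  then have enum: "bij_betw (\<lambda>i. inverse (r i)) {1..s} (distinct_roots (reciprocal f))"
    using bij_betw_trans[OF assms(4)] by (simp add: o_def)

  define D where "D = (\<Prod>(i, j)\<in>index_pairs s. (r i - r j) ^ (2 * m i * m j))"
  define P where "P = (\<Prod>(i, j)\<in>index_pairs s. (r i * r j) ^ (2 * m i * m j))"
  define e where "e = 2 * int n - 2"
  have D0: "D \<noteq> 0"
    unfolding D_def using pairD inj_on_eq_iff[OF bij_betw_imp_inj_on[OF assms(4)]]
    by (auto simp: prod_zero_iff[OF finite_index_pairs])
  have P0: "P \<noteq> 0"
    unfolding P_def using pairD r0
    by (auto simp: prod_zero_iff[OF finite_index_pairs])
  have an0: "to_ac (a n) powi e \<noteq> 0"
    using assms(2) by (simp add: power_int_eq_0_iff)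

  have "(\<Prod>(i, j)\<in>index_pairs s. (r i - r j) ^ (2 * root_mult f (r i) * root_mult f (r j))) = D"
    unfolding D_def by (rule prod.cong) (use pairD assms(5) in auto)
  then have tol_f: "tol f = to_ac (a n) powi e * D"
    using tol_eq[OF assms(4)] by (simp add: deg coeff e_def)

  have "(\<Prod>(i, j)\<in>index_pairs s. (inverse (r i) - inverse (r j)) ^
          (2 * root_mult (reciprocal f) (inverse (r i)) * root_mult (reciprocal f) (inverse (r j))))
      = (\<Prod>(i, j)\<in>index_pairs s. (r i - r j) ^ (2 * m i * m j) / (r i * r j) ^ (2 * m i * m j))"
  proof (rule prod.cong[OF refl], clarify)
    fix i j assume "(i, j) \<in> index_pairs s"
    note ij = pairD[OF this]
    show "(inverse (r i) - inverse (r j)) ^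
          (2 * root_mult (reciprocal f) (inverse (r i)) * root_mult (reciprocal f) (inverse (r j)))
      = (r i - r j) ^ (2 * m i * m j) / (r i * r j) ^ (2 * m i * m j)"
      unfolding root_mult_reciprocal[OF f0 r0[OF ij(1)]] root_mult_reciprocal[OF f0 r0[OF ij(2)]]
        assms(5)[OF ij(1), symmetric] assms(5)[OF ij(2), symmetric] mult.assoc
      by (rule inverse_diff_even_power[OF r0[OF ij(1)] r0[OF ij(2)]])
  qed
  also have "\<dots> = D / P"
    by (simp add: D_def P_def prod_dividef case_prod_unfold)
  finally have tol_rec: "tol (reciprocal f) = to_ac (a 0) powi e * (D / P)"
    using tol_eq[OF enum] c0 by (simp add: deg coeff coeff_reflect_poly e_def)

  have "tol f = tol (reciprocal f) \<longleftrightarrow> to_ac (a n) powi e * P = to_ac (a 0) powi e"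
    unfolding tol_f tol_rec using D0 P0 by (simp add: field_simps)
  also have "\<dots> \<longleftrightarrow> P = to_ac (a 0 / a n) powi e"
    using an0 by (simp add: to_ac_divide power_int_divide_distrib field_simps)
  finally show ?thesis
    unfolding P_def e_def .
qed

end
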